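(* Let $C,t>0$ and let $\nu$ be a Borel probability measure on $\mathbb{R}^q$ with compact support $K_\nu$ such that $|K_\nu|\leq 1$ and $\sup_{x\in\mathbb{R}^q}\nu(B(x,\epsilon))\leq C\epsilon^t$ for every $\epsilon>0$. For each $k\geq 2$, there exists a number $g_k>0$ such that, for every $\alpha_k\in C_k(\nu)$, every Voronoi partition $\{P_a(\alpha_k)\}_{a\in\alpha_k}$ with respect to $\alpha_k$ and every $a\in\alpha_k$, the set $P_a(\alpha_k)$ contains a closed ball of radius $g_k|P_a(\alpha_k)\cap K_\nu|$ which is centered at $a$.
   Context: $d$ is the Euclidean metric on $\mathbb{R}^q$, $B(x,\epsilon)$ is the closed ball of radius $\epsilon$ centered at $x$, and $|B|$ is the diameter of a set $B$. For $x\in\mathbb{R}^q$ and non-empty $\alpha\subset\mathbb{R}^q$, $d(x,\alpha):=\inf_{a\in\alpha}d(x,a)$. For $k\geq1$, $C_k(\nu)$ is the collection of all sets $\alpha\subset\mathbb{R}^q$ with $1\leq\mathrm{card}(\alpha)\leq k$ at which the infimum $\inf\{\exp(\int\log d(x,\alpha)\,d\nu(x)):\alpha\subset\mathbb{R}^q,\,1\leq\mathrm{card}(\alpha)\leq k\}$ is attained ($k$-optimal sets of order zero). For a non-empty finite set $\alpha\subset\mathbb{R}^q$ and $a\in\alpha$, let $W(a|\alpha):=\{x\in\mathbb{R}^q:d(x,\alpha)=d(x,a)\}$. A Voronoi partition with respect to $\alpha$ is a Borel partition $\{P_a(\alpha)\}_{a\in\alpha}$ of $\mathbb{R}^q$ such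 that $P_a(\alpha)\subset W(a|\alpha)$ for every $a\in\alpha$. *)

theory Defs
  imports "HOL-Probability.Probability"
begin

definition topological_support :: "'a::topological_space measure \<Rightarrow> 'a set" where
  "topological_support \<nu> = \<Inter> {F. closed F \<and> emeasure \<nu> (- F) = 0}"

(* exp of the integral of log d(x,\<alpha>), with the conventions log 0 = -infinity and
   exp (-infinity) = 0.  For a probability measure of compact support, log d(x,\<alpha>) is
   bounded above almost everywhere, so its integral always exists in [-infinity, infinity);
   it is -infinity exactly when the condition below fails.  The condition is needed because
   ln 0 = 0 for the library's ln and because the library's integral of a non-integrable
   function is 0. *)
definition geometric_mean_error :: "'a::euclidean_space measure \<Rightarrow> 'a set \<Rightarrow> real" where
  "geometric_mean_error \<nu> \<alpha> =
     (if (AE x in \<nu>. infdist x \<alpha> > 0) \<and> integrable \<nu> (\<lambda>x. ln (infdist x \<alpha>))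
      then exp (\<integral>x. ln (infdist x \<alpha>) \<partial>\<nu>)
      else 0)"

(* 1 \<le> card \<alpha> also forces \<alpha> to be finite *)
definition optimal_sets :: "nat \<Rightarrow> 'a::euclidean_space measure \<Rightarrow> 'a set set" where
  "optimal_sets k \<nu> =
     {\<alpha>. 1 \<le> card \<alpha> \<and> card \<alpha> \<le> k \<and>
         geometric_mean_error \<nu> \<alpha> =
           (INF \<beta>\<in>{\<beta>. 1 \<le> card \<beta> \<and> card \<beta> \<le> k}. geometric_mean_error \<nu> \<beta>)}"

definition voronoi_region :: "'a::metric_space \<Rightarrow> 'a set \<Rightarrow> 'a set" where
  "voronoi_region a \<alpha> = {x. infdist x \<alpha> = dist x a}"

(* The cells are automatically non-empty for finite \<alpha>: a belongs to no region but its own. *)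
definition voronoi_partition :: "'a::metric_space set \<Rightarrow> ('a \<Rightarrow> 'a set) \<Rightarrow> bool" where
  "voronoi_partition \<alpha> P \<longleftrightarrow>
     (\<forall>a\<in>\<alpha>. P a \<in> sets borel \<and> P a \<subseteq> voronoi_region a \<alpha>) \<and>
     disjoint_family_on P \<alpha> \<and> (\<Union>a\<in>\<alpha>. P a) = UNIV"

end

theory Submission
  imports Defs
begin

text \<open>
  The points of an optimal set are separated by a distance that depends only on \<open>k\<close> and \<open>\<nu>\<close>.
  If \<open>a\<close> and \<open>b\<close> in \<open>\<alpha>\<close> are at distance \<open>\<eta>\<close>, then deleting \<open>b\<close> raises the logarithmic error by
  at most \<open>\<integral> ln (1 + \<eta> / d(x,b)) d\<nu>(x)\<close>, which is \<open>O(\<eta>\<^sup>p)\<close> uniformly in \<open>b\<close> because the ball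
  condition bounds \<open>\<integral> d(x,b)\<^bsup>-p\<^esup> d\<nu>(x)\<close> uniformly for \<open>p < t\<close>. The ball condition also yields a
  point of the support at distance at least \<open>r = r(k)\<close> from the remaining points, and adding a
  point near it lowers the error by at least \<open>m ln 2\<close>, where \<open>m\<close> is the least mass of a ball in a
  finite cover of the support. Optimality forces \<open>m ln 2 = O(\<eta>\<^sup>p)\<close>. As the support has diameter at
  most 1, a third of the separation serves as \<open>g\<^sub>k\<close>.
\<close>

section \<open>Elementary bounds for logarithms and powers\<close>

lemma abs_ln_le_powr:
  fixes y p :: real
  assumes "y > 0" "p > 0"
  shows "\<bar>ln y\<bar> \<le> y + y powr (-p) / p"
proof (cases "y \<ge> 1")
  case True
  then have "\<bar>ln y\<bar> \<le> y"
    using ln_le_minus_one[of y] by simp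
  also have "\<dots> \<le> y + y powr (-p) / p"
    using assms by simp
  finally show ?thesis .
next
  case False
  then have "\<bar>ln y\<bar> = ln (1 / y)"
    using assms by (simp add: ln_div)
  also have "\<dots> \<le> (1 / y) powr p / p"
    using False assms by (intro ln_powr_bound) auto
  also have "\<dots> = y powr (-p) / p"
    using assms by (simp add: powr_divide powr_minus_divide)
  finally show ?thesis
    using assms by simp
qed

text \<open>For \<open>y \<le> 1\<close> the bound passes through \<open>y \<le> y powr p\<close>,
  which is where \<open>p \<le> 1\<close> enters. For \<open>y > 1\<close> it uses
  \<open>1 + y \<le> 2 * y\<close>, and the constant 2 absorbs \<open>2 powr p\<close>.\<close>

lemma ln_add_one_le_powr:
  fixes y p :: real
  assumes "y \<ge> 0" "0 < p" "p \<le> 1"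
  shows "ln (1 + y) \<le> 2 * y powr p / p"
proof (cases "y \<le> 1")
  case True
  have "ln (1 + y) \<le> y powr 1"
    using assms by (simp add: ln_add_one_self_le_self)
  also have "\<dots> \<le> y powr p"
    using assms True by (intro powr_mono') auto
  also have "\<dots> \<le> 2 * y powr p / p"
  proof -
    have "p * y powr p \<le> 2 * y powr p"
      using assms by (intro mult_right_mono) auto
    then show ?thesis
      using assms by (simp add: field_simps)
  qed
  finally show ?thesis .
next
  case False
  have "ln (1 + y) \<le> (1 + y) powr p / p"
    using assms by (intro ln_powr_bound) auto
  also have "\<dots> \<le> (2 * y) powr p / p"
    using assms False by (intro divide_right_mono powr_mono2) auto
  also have "\<dots> = 2 powr p * y powr p / p"
    using assms by (simp add: powr_mult)
  also have "\<dots> \<le> 2 powr 1 * y powr p / p"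
    using assms by (intro divide_right_mono mult_right_mono powr_mono) auto
  finally show ?thesis
    by simp
qed

text \<open>Taking \<open>n\<close> as the integer part of \<open>- log 2 y\<close> places
  \<open>y\<close> in a dyadic shell. This lets a negative power of a distance be dominated by a
  weighted sum of indicators of balls.\<close>

lemma powr_minus_le_dyadic:
  fixes y p :: real
  assumes "0 < y" "y \<le> 1" "p > 0"
  obtains n :: nat where "y \<le> 2 powr (- real n)" "y powr (-p) \<le> 2 powr (p * (real n + 1))"
proof -
  define n where "n = nat \<lfloor>- log 2 y\<rfloor>"
  have nonneg: "- log 2 y \<ge> 0"
    using assms by simp
  have "real n \<le> - log 2 y" "- log 2 y \<le> real n + 1"
    unfolding n_def using nonneg by linarith+
  moreover have y: "y = 2 powr (log 2 y)"
    using assms by simp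
  moreover have "y powr (-p) = 2 powr (p * (- log 2 y))"
    by (subst y, subst powr_powr) (simp add: mult.commute)
  ultimately show thesis
    using assms mult_left_mono[of "- log 2 y" "real n + 1" p]
    by (intro that[of n]) (metis powr_mono le_minus_iff one_le_numeral, simp)
qed

section \<open>The topological support\<close>

lemma emeasure_open_neq_0:
  assumes "x \<in> topological_support \<nu>" "open U" "x \<in> U"
  shows "emeasure \<nu> U \<noteq> 0"
proof
  assume "emeasure \<nu> U = 0"
  then have "topological_support \<nu> \<subseteq> - U"
    unfolding topological_support_def using assms by (intro Inter_lower) auto
  then show False
    using assms by auto
qed

text \<open>The complement of the support is the union of all open null sets. By the Lindelof
  property countably many of them have the same union, so it is null.\<close>

lemma AE_in_topological_support:
  fixes \<nu> :: "'a::second_countable_topology measure"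
  assumes "sets \<nu> = sets borel"
  shows "AE x in \<nu>. x \<in> topological_support \<nu>"
proof -
  let ?\<U> = "{U. open U \<and> emeasure \<nu> U = 0}"
  obtain \<V> where \<V>: "\<V> \<subseteq> ?\<U>" "countable \<V>" "\<Union>\<V> = \<Union>?\<U>"
    using Lindelof[of ?\<U>] by auto
  have "(\<Union>U\<in>\<V>. U) \<in> null_sets \<nu>"
    using \<V> assms by (intro null_sets_UN') (auto simp: null_sets_def)
  moreover have "- topological_support \<nu> = \<Union>?\<U>"
  proof -
    have "- topological_support \<nu> = \<Union>(uminus ` {F. closed F \<and> emeasure \<nu> (- F) = 0})"
      unfolding topological_support_def by auto
    also have "uminus ` {F. closed F \<and> emeasure \<nu> (- F) = 0} = ?\<U>"
    proof (intro equalityI subsetI)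
      fix U assume "U \<in> ?\<U>"
      then show "U \<in> uminus ` {F. closed F \<and> emeasure \<nu> (- F) = 0}"
        by (intro image_eqI[of _ _ "- U"]) auto
    qed auto
    finally show ?thesis .
  qed
  ultimately show ?thesis
    using \<V> by (intro AE_I'[of "- topological_support \<nu>"]) auto
qed

section \<open>Optimality and the exchange of one point\<close>

lemma geometric_mean_error_nonneg: "geometric_mean_error \<nu> \<alpha> \<ge> 0"
  by (simp add: geometric_mean_error_def)

lemma optimal_setsD:
  assumes "\<alpha> \<in> optimal_sets k \<nu>" "1 \<le> card \<beta>" "card \<beta> \<le> k"
  shows "geometric_mean_error \<nu> \<alpha> \<le> geometric_mean_error \<nu> \<beta>"
proof -
  have "bdd_below (geometric_mean_error \<nu> ` {\<beta>. 1 \<le> card \<beta> \<and> card \<beta> \<le> k})"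
    by (intro bdd_belowI2[of _ 0] geometric_mean_error_nonneg)
  then show ?thesis
    using assms by (auto simp: optimal_sets_def intro!: cINF_lower)
qed

text \<open>The exchange is a deletion followed by an insertion. When \<open>b\<close> is the
  nearest point, \<open>a\<close> replaces it at an extra distance of at most
  \<open>dist a b\<close>, which gives the factor \<open>1 + dist a b / dist x b\<close>. Inserting
  \<open>c\<close> then at least halves the distance on \<open>U\<close> and never increases it
  elsewhere. Excluding \<open>x\<close> from \<open>insert c \<alpha>\<close> makes every logarithm
  one of a positive number.\<close>

lemma ln_infdist_exchange:
  fixes x :: "'a::heine_borel"
  assumes "finite \<alpha>" "a \<in> \<alpha>" "b \<in> \<alpha>" "a \<noteq> b" "x \<notin> insert c \<alpha>"
    and far: "x \<in> U \<Longrightarrow> 2 * dist x c \<le> infdist x (\<alpha> - {b})"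
  shows "ln (infdist x (insert c (\<alpha> - {b})))
           \<le> ln (infdist x \<alpha>) + ln (1 + dist a b / dist x b) - ln 2 * indicator U x"
proof -
  let ?\<alpha>' = "\<alpha> - {b}" and ?\<beta> = "insert c (\<alpha> - {b})"
  have pos: "infdist x \<alpha> > 0" "infdist x ?\<alpha>' > 0" "infdist x ?\<beta> > 0" "dist x b > 0"
    using assms by (auto intro!: infdist_pos_not_in_closed finite_imp_closed)
  have remove: "infdist x ?\<alpha>' \<le> infdist x \<alpha> * (1 + dist a b / dist x b)"
  proof -
    obtain e where e: "e \<in> \<alpha>" "infdist x \<alpha> = dist x e"
      using infdist_attains_inf[OF finite_imp_closed, of \<alpha> x] assms by auto
    show ?thesis
    proof (cases "e = b")
      case True
      have "infdist x ?\<alpha>' \<le> dist x a"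
        using assms by (intro infdist_le) auto
      also have "\<dots> \<le> dist x b + dist a b"
        by metric
      also have "\<dots> = infdist x \<alpha> * (1 + dist a b / dist x b)"
        using True e pos by (simp add: field_simps)
      finally show ?thesis .
    next
      case False
      have "infdist x ?\<alpha>' \<le> infdist x \<alpha> * 1"
        using False e by (simp add: infdist_le)
      also have "\<dots> \<le> infdist x \<alpha> * (1 + dist a b / dist x b)"
        using pos by (intro mult_left_mono) auto
      finally show ?thesis .
    qed
  qed
  have add: "ln (infdist x ?\<beta>) \<le> ln (infdist x ?\<alpha>') - ln 2 * indicator U x"
  proof (cases "x \<in> U")
    case True
    have "infdist x ?\<beta> \<le> infdist x ?\<alpha>' / 2"
      using far[OF True] infdist_le[of c ?\<beta> x] by simp
    then have "ln (infdist x ?\<beta>) \<le> ln (infdist x ?\<alpha>' / 2)"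
      using pos by simp
    then show ?thesis
      using pos True by (simp add: ln_div)
  next
    case False
    have "infdist x ?\<beta> \<le> infdist x ?\<alpha>'"
      using assms by (intro infdist_mono) auto
    then show ?thesis
      using pos False by simp
  qed
  have q: "1 + dist a b / dist x b > 0"
    by (simp add: add_pos_nonneg)
  have "ln (infdist x ?\<alpha>') \<le> ln (infdist x \<alpha> * (1 + dist a b / dist x b))"
    using remove pos q by (subst ln_le_cancel_iff) auto
  also have "\<dots> = ln (infdist x \<alpha>) + ln (1 + dist a b / dist x b)"
    using pos q by (simp add: ln_mult_pos)
  finally show ?thesis
    using add by linarith
qed

section \<open>Measures with the ball condition: null points, negative moments, integrable
  logarithms\<close>

locale frostman_measure = prob_space \<nu> for \<nu> :: "'a::euclidean_space measure" +
  fixes C t :: real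
  assumes t_pos: "t > 0"
    and sets_eq [measurable_cong, simp]: "sets \<nu> = sets borel"
    and measure_cball_le: "\<epsilon> > 0 \<Longrightarrow> measure \<nu> (cball x \<epsilon>) \<le> C * \<epsilon> powr t"
    and compact_support: "compact (topological_support \<nu>)"
begin

lemma C_pos: "C > 0"
proof -
  obtain x where x: "x \<in> topological_support \<nu>"
    using eventually_happens[OF AE_in_topological_support[OF sets_eq]] ae_filter_bot by blast
  have "0 < measure \<nu> (cball x 1)"
    using emeasure_open_neq_0[OF x, of "ball x 1"]
      emeasure_mono[of "ball x 1" "cball x 1" \<nu>] ball_subset_cball[of x 1]
    by (simp add: emeasure_eq_measure)
       (metis less_le_trans measure_nonneg order_le_imp_less_or_eq)
  then show ?thesis
    using measure_cball_le[of 1 x] by simp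
qed

text \<open>Let the radius tend to 0 in the ball condition. Finite sets are therefore null, so the
  distance to one is positive almost everywhere.\<close>

lemma measure_singleton: "measure \<nu> {x} = 0"
proof -
  have "((\<lambda>\<epsilon>. C * \<epsilon> powr t) \<longlongrightarrow> C * 0 powr t) (at_right 0)"
    using t_pos by (intro tendsto_intros) (auto simp: eventually_at_filter)
  moreover have "eventually (\<lambda>\<epsilon>. measure \<nu> {x} \<le> C * \<epsilon> powr t) (at_right 0)"
    using eventually_at_right_less[of 0]
  proof eventually_elim
    case (elim \<epsilon>)
    then have "measure \<nu> {x} \<le> measure \<nu> (cball x \<epsilon>)"
      by (intro finite_measure_mono) auto
    with measure_cball_le[OF elim, of x] show ?case
      by simp
  qed
  ultimately have "measure \<nu> {x} \<le> C * 0 powr t"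
    by (intro tendsto_lowerbound) auto
  then show ?thesis
    by (simp add: measure_le_0_iff)
qed

lemma AE_notin_finite:
  assumes "finite \<alpha>"
  shows "AE x in \<nu>. x \<notin> \<alpha>"
proof -
  have "AE x in \<nu>. \<forall>a\<in>\<alpha>. x \<noteq> a"
  proof (intro AE_finite_allI assms)
    fix a
    have "{a} \<in> null_sets \<nu>"
      using measure_singleton[of a] by (auto simp: emeasure_eq_measure)
    then show "AE x in \<nu>. x \<noteq> a"
      by (rule AE_I') auto
  qed
  then show ?thesis
    by eventually_elim auto
qed

text \<open>A dyadic decomposition around \<open>a\<close>: the ball of radius
  \<open>2 powr (- real n)\<close> carries the weight \<open>2 powr (p * (real n + 1))\<close> and
  has mass at most \<open>C * 2 powr (- real n * t)\<close>. The products form a geometric series of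
  ratio \<open>2 powr (p - t) < 1\<close>, whose sum does not depend on \<open>a\<close>.\<close>

lemma nn_integral_dist_powr_le:
  assumes "0 < p" "p < t"
  shows "(\<integral>\<^sup>+x. ennreal (dist x a powr (-p)) \<partial>\<nu>)
           \<le> ennreal (1 + (\<Sum>n. C * 2 powr p * (2 powr (p - t)) ^ n))"
proof -
  let ?w = "\<lambda>n::nat. ennreal (2 powr (p * (real n + 1)))"
  let ?B = "\<lambda>n::nat. cball a (2 powr (- real n))"
  have pointwise: "ennreal (dist x a powr (-p)) \<le> 1 + (\<Sum>n. ?w n * indicator (?B n) x)" for x
  proof (cases "x = a \<or> dist x a > 1")
    \<comment> \<open>At \<open>x = a\<close> the integrand is \<open>0 powr (-p) = 0\<close>, so
      the constant 1 covers this point as well as the points outside the unit ball.\<close>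
    case True
    have "dist x a powr (-p) \<le> 1 powr (-p)" if "dist x a > 1"
      using that assms by (intro powr_mono2') auto
    then have "ennreal (dist x a powr (-p)) \<le> 1"
      using True by auto
    then show ?thesis
      by (rule order_trans) simp
  next
    case False
    then obtain n :: nat where n: "dist x a \<le> 2 powr (- real n)"
      "dist x a powr (-p) \<le> 2 powr (p * (real n + 1))"
      using powr_minus_le_dyadic[of "dist x a" p] assms by auto
    have "ennreal (dist x a powr (-p)) \<le> ?w n * indicator (?B n) x"
      using n by (auto simp: dist_commute indicator_def intro!: ennreal_leI)
    also have "\<dots> \<le> (\<Sum>n. ?w n * indicator (?B n) x)"
      using sum_le_suminf[of "\<lambda>n. ?w n * indicator (?B n) x" "{n}"]
      by (simp del: sum_mult_indicator)
    also have "\<dots> \<le> 1 + (\<Sum>n. ?w n * indicator (?B n) x)"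
      by simp
    finally show ?thesis .
  qed
  have summable: "summable (\<lambda>n. C * 2 powr p * (2 powr (p - t)) ^ n)"
  proof (intro summable_mult summable_geometric)
    have "2 powr (p - t) < 2 powr (0::real)"
      using assms by (intro powr_less_mono) auto
    then show "norm (2 powr (p - t)) < 1"
      by simp
  qed
  have term_le: "?w n * emeasure \<nu> (?B n) \<le> ennreal (C * 2 powr p * (2 powr (p - t)) ^ n)" for n
  proof -
    have "2 powr (p * (real n + 1)) * measure \<nu> (?B n)
            \<le> 2 powr (p * (real n + 1)) * (C * (2 powr (- real n)) powr t)"
      by (intro mult_left_mono measure_cball_le) auto
    also have "\<dots> = C * 2 powr p * (2 powr (p - t)) ^ n"
      by (simp add: powr_powr powr_realpow[symmetric] powr_add[symmetric] algebra_simps)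
    finally show ?thesis
      by (simp add: emeasure_eq_measure ennreal_mult[symmetric] ennreal_leI)
  qed
  have meas: "(\<lambda>x. ?w n * indicator (?B n) x) \<in> borel_measurable \<nu>" for n
    by (intro borel_measurable_times_ennreal borel_measurable_const borel_measurable_indicator) auto
  have "(\<integral>\<^sup>+x. ennreal (dist x a powr (-p)) \<partial>\<nu>)
          \<le> (\<integral>\<^sup>+x. 1 + (\<Sum>n. ?w n * indicator (?B n) x) \<partial>\<nu>)"
    by (intro nn_integral_mono pointwise)
  also have "\<dots> = (\<integral>\<^sup>+x. 1 \<partial>\<nu>) + (\<integral>\<^sup>+x. (\<Sum>n. ?w n * indicator (?B n) x) \<partial>\<nu>)"
    by (rule nn_integral_add[OF borel_measurable_const borel_measurable_suminf_order[OF meas]])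
  also have "\<dots> = 1 + (\<Sum>n. \<integral>\<^sup>+x. ?w n * indicator (?B n) x \<partial>\<nu>)"
    by (subst nn_integral_suminf[OF meas]) (simp add: emeasure_space_1)
  also have "\<dots> = 1 + (\<Sum>n. ?w n * emeasure \<nu> (?B n))"
    by (subst nn_integral_cmult_indicator) auto
  also have "\<dots> \<le> 1 + (\<Sum>n. ennreal (C * 2 powr p * (2 powr (p - t)) ^ n))"
    by (intro add_left_mono suminf_le term_le) auto
  also have "\<dots> = 1 + ennreal (\<Sum>n. C * 2 powr p * (2 powr (p - t)) ^ n)"
    using C_pos summable by (subst suminf_ennreal2) auto
  also have "\<dots> = ennreal (1 + (\<Sum>n. C * 2 powr p * (2 powr (p - t)) ^ n))"
    using C_pos summable by (subst ennreal_plus) (auto intro!: suminf_nonneg)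
  finally show ?thesis .
qed

lemma integrable_dist_powr:
  assumes "0 < p" "p < t"
  shows "integrable \<nu> (\<lambda>x. dist x a powr (-p))"
proof (rule integrableI_nonneg)
  show "(\<integral>\<^sup>+x. ennreal (dist x a powr (-p)) \<partial>\<nu>) < \<infinity>"
    using nn_integral_dist_powr_le[OF assms, of a] by (rule le_less_trans) simp
qed auto

lemma integral_dist_powr_bounded:
  assumes "0 < p" "p < t"
  obtains M where "M > 0" "\<And>a. (\<integral>x. dist x a powr (-p) \<partial>\<nu>) \<le> M"
proof
  let ?M = "1 + (\<Sum>n. C * 2 powr p * (2 powr (p - t)) ^ n)"
  fix a
  have "ennreal (\<integral>x. dist x a powr (-p) \<partial>\<nu>) \<le> ennreal ?M"
    using nn_integral_dist_powr_le[OF assms, of a] integrable_dist_powr[OF assms, of a]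
    by (subst nn_integral_eq_integral[symmetric]) auto
  \<comment> \<open>The maximum with 1 makes the bound positive whatever the sign of
    \<open>?M\<close>.\<close>
  then show "(\<integral>x. dist x a powr (-p) \<partial>\<nu>) \<le> max 1 ?M"
    unfolding ennreal_le_iff2 by linarith
qed auto

text \<open>Compactness bounds the distance on the support by \<open>R\<close>, and negative powers
  control the logarithm near \<open>\<alpha>\<close>. Summing these powers over all of
  \<open>\<alpha>\<close> gives a dominating function that does not refer to the point nearest to
  \<open>x\<close>.\<close>

lemma integrable_ln_infdist:
  assumes "finite \<alpha>" "\<alpha> \<noteq> {}"
  shows "integrable \<nu> (\<lambda>x. ln (infdist x \<alpha>))"
proof -
  define p where "p = t / 2"
  have p: "0 < p" "p < t"
    using t_pos by (auto simp: p_def)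
  obtain a\<^sub>0 where "a\<^sub>0 \<in> \<alpha>"
    using assms by auto
  obtain R where R: "\<And>x. x \<in> topological_support \<nu> \<Longrightarrow> dist a\<^sub>0 x \<le> R"
    using compact_imp_bounded[OF compact_support] bounded_any_center by metis
  have "(\<lambda>x. infdist x \<alpha>) \<in> borel_measurable \<nu>"
    by (subst measurable_cong_sets[OF sets_eq refl])
      (intro borel_measurable_continuous_onI continuous_intros)
  show ?thesis
  proof (rule Bochner_Integration.integrable_bound)
    show "integrable \<nu> (\<lambda>x. R + (\<Sum>a\<in>\<alpha>. dist x a powr (-p)) / p)"
      using integrable_dist_powr[OF p] by auto
    show "AE x in \<nu>. norm (ln (infdist x \<alpha>)) \<le> norm (R + (\<Sum>a\<in>\<alpha>. dist x a powr (-p)) / p)"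
      using AE_in_topological_support[OF sets_eq] AE_notin_finite[OF assms(1)]
    proof eventually_elim
      case (elim x)
      obtain a where a: "a \<in> \<alpha>" "infdist x \<alpha> = dist x a"
        using infdist_attains_inf[OF finite_imp_closed, of \<alpha> x] assms by auto
      then have "\<bar>ln (infdist x \<alpha>)\<bar> \<le> infdist x \<alpha> + dist x a powr (-p) / p"
        using elim p abs_ln_le_powr[of "dist x a" p] by auto
      also have "infdist x \<alpha> \<le> R"
        using R[OF elim(1)] infdist_le[OF \<open>a\<^sub>0 \<in> \<alpha>\<close>, of x] by (simp add: dist_commute)
      also have "dist x a powr (-p) \<le> (\<Sum>a\<in>\<alpha>. dist x a powr (-p))"
        using a assms by (intro member_le_sum) auto
      finally show ?case
        using p by (simp add: divide_right_mono)
    qed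
  qed (intro borel_measurable_ln, fact)
qed

lemma AE_infdist_pos:
  assumes "finite \<alpha>" "\<alpha> \<noteq> {}"
  shows "AE x in \<nu>. infdist x \<alpha> > 0"
  using AE_notin_finite[OF assms(1)]
proof eventually_elim
  case (elim x)
  then show ?case
    using assms by (simp add: finite_imp_closed infdist_pos_not_in_closed)
qed

text \<open>The default value 0 never occurs for a finite non-empty set, so comparing errors amounts
  to comparing integrals of logarithms.\<close>

lemma geometric_mean_error_eq:
  assumes "finite \<alpha>" "\<alpha> \<noteq> {}"
  shows "geometric_mean_error \<nu> \<alpha> = exp (\<integral>x. ln (infdist x \<alpha>) \<partial>\<nu>)"
  using AE_infdist_pos integrable_ln_infdist assms by (simp add: geometric_mean_error_def)

section \<open>Balls of definite mass far from few points, and the separation of optimal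
  sets\<close>

lemma exists_far_ball:
  obtains r m where "m > 0"
    "\<And>\<alpha>. finite \<alpha> \<Longrightarrow> card \<alpha> \<le> k \<Longrightarrow> \<alpha> \<noteq> {} \<Longrightarrow>
       \<exists>c. measure \<nu> (ball c r) \<ge> m \<and> (\<forall>x\<in>ball c r. 2 * dist x c \<le> infdist x \<alpha>)"
proof -
  let ?K = "topological_support \<nu>"
  \<comment> \<open>The radius is chosen so that \<open>k\<close> balls of radius \<open>s\<close>
    have total mass at most \<open>k / (2 * (k + 1)) < 1\<close>.\<close>
  define s where "s = (1 / (2 * (real k + 1) * C)) powr (1 / t)"
  have "s > 0"
    using C_pos by (auto simp: s_def)
  have s: "C * s powr t = 1 / (2 * (real k + 1))"
    using C_pos t_pos by (simp add: s_def powr_powr)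
  obtain F where F: "F \<subseteq> ?K" "finite F" "?K \<subseteq> (\<Union>c\<in>F. ball c (s/4))"
  proof (rule compactE_image[OF compact_support])
    show "?K \<subseteq> (\<Union>c\<in>?K. ball c (s/4))"
      using \<open>s > 0\<close> by force
  qed auto
  \<comment> \<open>The finite cover is fixed before \<open>\<alpha>\<close> is given, so
    \<open>m\<close> serves all sets of at most \<open>k\<close> points. The inserted 1 keeps the
    minimum over a non-empty set.\<close>
  define m where "m = Min (insert 1 ((\<lambda>c. measure \<nu> (ball c (s/4))) ` F))"
  have "measure \<nu> (ball c (s/4)) > 0" if "c \<in> F" for c
    using emeasure_open_neq_0[of c \<nu> "ball c (s/4)"] that F \<open>s > 0\<close>
    by (auto simp: emeasure_eq_measure zero_less_measure_iff)
  then have "m > 0"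
    using F by (auto simp: m_def)
  show thesis
  proof (rule that[of m "s/4"])
    fix \<alpha> :: "'a set"
    assume \<alpha>: "finite \<alpha>" "card \<alpha> \<le> k" "\<alpha> \<noteq> {}"
    have "measure \<nu> (\<Union>a\<in>\<alpha>. cball a s) \<le> (\<Sum>a\<in>\<alpha>. measure \<nu> (cball a s))"
      using \<alpha> by (intro finite_measure_subadditive_finite) auto
    also have "\<dots> \<le> (\<Sum>a\<in>\<alpha>. C * s powr t)"
      using \<open>s > 0\<close> by (intro sum_mono measure_cball_le)
    also have "\<dots> = real (card \<alpha>) / (2 * (real k + 1))"
      by (simp add: s)
    also have "\<dots> < 1"
      using \<alpha> by simp
    \<comment> \<open>The balls around \<open>\<alpha>\<close> miss positive mass, and almost every
      point lies in the support, so some support point escapes them.\<close>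
    finally have "\<not> (AE x in \<nu>. x \<in> (\<Union>a\<in>\<alpha>. cball a s))"
      using \<alpha> by (subst AE_in_set_eq_1) auto
    then obtain x where x: "x \<in> ?K" "x \<notin> (\<Union>a\<in>\<alpha>. cball a s)"
      using AE_in_topological_support[OF sets_eq] by (metis (no_types, lifting) AE_mp AE_I2)
    obtain c where c: "c \<in> F" "dist c x < s/4"
      using x F by auto
    \<comment> \<open>Both \<open>dist y c\<close> and \<open>dist c x\<close> are below
      \<open>s/4\<close>, while \<open>x\<close> is farther than \<open>s\<close> from
      \<open>\<alpha>\<close>. So \<open>y\<close> keeps a distance above \<open>s/2\<close> from
      \<open>\<alpha>\<close>, which exceeds \<open>2 * dist y c\<close>.\<close>
    have "2 * dist y c \<le> infdist y \<alpha>" if "y \<in> ball c (s/4)" for y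
    proof -
      obtain a where a: "a \<in> \<alpha>" "infdist y \<alpha> = dist y a"
        using infdist_attains_inf[OF finite_imp_closed, of \<alpha> y] \<alpha> by auto
      then have "dist a x > s"
        using x by auto
      then show ?thesis
        using a c that dist_triangle[of a x y] dist_triangle[of y x c]
        by (simp add: dist_commute)
    qed
    moreover have "m \<le> measure \<nu> (ball c (s/4))"
      using c F by (auto simp: m_def)
    ultimately show "\<exists>c. measure \<nu> (ball c (s/4)) \<ge> m \<and>
        (\<forall>x\<in>ball c (s/4). 2 * dist x c \<le> infdist x \<alpha>)"
      by auto
  qed fact
qed

lemma optimal_sets_separated:
  obtains \<eta> where "\<eta> > 0"
    "\<And>\<alpha> a b. \<alpha> \<in> optimal_sets k \<nu> \<Longrightarrow> a \<in> \<alpha> \<Longrightarrow> b \<in> \<alpha> \<Longrightarrow> a \<noteq> b \<Longrightarrow> \<eta> \<le> dist a b"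
proof -
  \<comment> \<open>\<open>p < t\<close> gives the uniform negative moment, and
    \<open>p \<le> 1\<close> the power bound for \<open>ln (1 + y)\<close>.\<close>
  define p where "p = min 1 (t / 2)"
  have p: "0 < p" "p < t" "p \<le> 1"
    using t_pos by (auto simp: p_def)
  obtain M where M: "M > 0" "\<And>a. (\<integral>x. dist x a powr (-p) \<partial>\<nu>) \<le> M"
    using integral_dist_powr_bounded[OF p(1,2)] by metis
  obtain r m where "m > 0" and far:
    "\<And>\<alpha>. finite \<alpha> \<Longrightarrow> card \<alpha> \<le> k \<Longrightarrow> \<alpha> \<noteq> {} \<Longrightarrow>
       \<exists>c. measure \<nu> (ball c r) \<ge> m \<and> (\<forall>x\<in>ball c r. 2 * dist x c \<le> infdist x \<alpha>)"
    using exists_far_ball[of k] by metis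
  \<comment> \<open>This is the distance at which the bound on the deletion cost,
    \<open>2 * \<eta> powr p / p * M\<close>, equals the guaranteed gain
    \<open>ln 2 * m\<close>.\<close>
  define \<eta> where "\<eta> = (ln 2 * m * p / (2 * M)) powr (1 / p)"
  show thesis
  proof (rule that[of \<eta>])
    show "\<eta> > 0"
      using \<open>m > 0\<close> M p by (simp add: \<eta>_def)
    fix \<alpha> a b
    assume opt: "\<alpha> \<in> optimal_sets k \<nu>" and ab: "a \<in> \<alpha>" "b \<in> \<alpha>" "a \<noteq> b"
    have \<alpha>: "finite \<alpha>" "card \<alpha> \<le> k"
      using opt by (auto simp: optimal_sets_def intro: card_ge_0_finite)
    let ?\<alpha>' = "\<alpha> - {b}"
    have "card ?\<alpha>' \<le> k"
      using \<alpha> by (meson card_Diff1_le le_trans)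
    then obtain c where c: "measure \<nu> (ball c r) \<ge> m"
      "\<And>x. x \<in> ball c r \<Longrightarrow> 2 * dist x c \<le> infdist x ?\<alpha>'"
      using far[of ?\<alpha>'] \<alpha> ab by blast
    let ?\<beta> = "insert c ?\<alpha>'" and ?q = "2 * dist a b powr p / p"
    have int: "integrable \<nu> (\<lambda>x. ln (infdist x \<alpha>))" "integrable \<nu> (\<lambda>x. ln (infdist x ?\<beta>))"
      "integrable \<nu> (\<lambda>x. ?q * dist x b powr (-p))"
      "integrable \<nu> (\<lambda>x. ln 2 * indicator (ball c r) x :: real)"
      using \<alpha> ab by (intro integrable_ln_infdist integrable_mult_right integrable_dist_powr[OF p(1,2)]
          integrable_real_indicator; auto simp: emeasure_eq_measure)+
    \<comment> \<open>One point leaves and at most one enters, so the new set still competes in the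
      infimum.\<close>
    have "card ?\<beta> \<le> Suc (card ?\<alpha>')"
      by (rule card_insert_le_m1) auto
    also have "\<dots> = card \<alpha>"
      using ab \<alpha> by (intro card_Suc_Diff1)
    finally have "card ?\<beta> \<le> k"
      using \<alpha> by simp
    moreover have "1 \<le> card ?\<beta>"
      using \<alpha> by (simp add: Suc_le_eq card_gt_0_iff)
    ultimately have "geometric_mean_error \<nu> \<alpha> \<le> geometric_mean_error \<nu> ?\<beta>"
      using optimal_setsD[OF opt] by simp
    then have "(\<integral>x. ln (infdist x \<alpha>) \<partial>\<nu>) \<le> (\<integral>x. ln (infdist x ?\<beta>) \<partial>\<nu>)"
      using \<alpha> ab by (subst (asm) (1 2) geometric_mean_error_eq) auto
    also have "\<dots> \<le> (\<integral>x. ln (infdist x \<alpha>) + ?q * dist x b powr (-p)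
                         - ln 2 * indicator (ball c r) x \<partial>\<nu>)"
    proof (rule integral_mono_AE)
      show "AE x in \<nu>. ln (infdist x ?\<beta>) \<le> ln (infdist x \<alpha>) + ?q * dist x b powr (-p)
              - ln 2 * indicator (ball c r) x"
        using AE_notin_finite[OF finite.insertI[OF \<alpha>(1), of c]]
      proof eventually_elim
        case (elim x)
        have "ln (1 + dist a b / dist x b) \<le> 2 * (dist a b / dist x b) powr p / p"
          using p by (intro ln_add_one_le_powr) auto
        also have "\<dots> = ?q * dist x b powr (-p)"
          by (simp add: powr_divide powr_minus_divide)
        finally show ?case
          using ln_infdist_exchange[OF \<alpha>(1) ab elim, of "ball c r", OF c(2)] by linarith
      qed
    qed (intro Bochner_Integration.integrable_add Bochner_Integration.integrable_diff int)+
    also have "\<dots> = (\<integral>x. ln (infdist x \<alpha>) \<partial>\<nu>) + ?q * (\<integral>x. dist x b powr (-p) \<partial>\<nu>)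
                    - ln 2 * measure \<nu> (ball c r)"
      using int by simp
    \<comment> \<open>The integral of \<open>ln (infdist x \<alpha>)\<close> is a finite real and
      cancels, leaving gain against cost.\<close>
    finally have "ln 2 * measure \<nu> (ball c r) \<le> ?q * (\<integral>x. dist x b powr (-p) \<partial>\<nu>)"
      by simp
    moreover have "?q * (\<integral>x. dist x b powr (-p) \<partial>\<nu>) \<le> ?q * M"
      using M p by (intro mult_left_mono) auto
    moreover have "ln 2 * m \<le> ln 2 * measure \<nu> (ball c r)"
      using c by simp
    ultimately have "ln 2 * m \<le> ?q * M"
      by linarith
    then have "ln 2 * m * p / (2 * M) \<le> dist a b powr p"
      using M p by (simp add: field_simps)
    then have "\<eta> \<le> (dist a b powr p) powr (1 / p)"
      unfolding \<eta>_def using M p \<open>m > 0\<close> by (intro powr_mono2) auto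
    then show "\<eta> \<le> dist a b"
      using p by (simp add: powr_powr)
  qed
qed

end

section \<open>From separation to balls inside Voronoi cells\<close>

lemma cball_subset_voronoi_cell:
  assumes "voronoi_partition \<alpha> P" "a \<in> \<alpha>"
    and sep: "\<And>c. c \<in> \<alpha> \<Longrightarrow> c \<noteq> a \<Longrightarrow> 2 * r < dist a c"
  shows "cball a r \<subseteq> P a"
proof
  fix x
  assume x: "x \<in> cball a r"
  have "x \<in> (\<Union>c\<in>\<alpha>. P c)"
    using assms by (simp add: voronoi_partition_def)
  then obtain c where c: "c \<in> \<alpha>" "x \<in> P c"
    by blast
  \<comment> \<open>The cell containing \<open>x\<close> belongs to a nearest point
    \<open>c\<close>, so \<open>a\<close> and \<open>c\<close> both lie within \<open>r\<close> of
    \<open>x\<close>. The strict separation then forces \<open>c = a\<close>, and no tie between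
    cells can interfere.\<close>
  then have "infdist x \<alpha> = dist x c"
    using assms by (auto simp: voronoi_partition_def voronoi_region_def)
  then have "dist x c \<le> dist x a"
    using infdist_le[OF assms(2), of x] by simp
  then have "dist a c \<le> 2 * r"
    using x dist_triangle[of a c x] by (simp add: dist_commute)
  then show "x \<in> P a"
    using sep[of c] c by fastforce
qed

theorem lemma3p4:
  fixes \<nu> :: "'a::euclidean_space measure" and C t :: real and k :: nat
  assumes "C > 0" and "t > 0"
    and "prob_space \<nu>" and "sets \<nu> = sets borel"
    and "compact (topological_support \<nu>)"
    and "diameter (topological_support \<nu>) \<le> 1"
    and "\<And>\<epsilon>. \<epsilon> > 0 \<Longrightarrow> (SUP x. measure \<nu> (cball x \<epsilon>)) \<le> C * \<epsilon> powr t"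
    and "k \<ge> 2"
  shows "\<exists>g>0. \<forall>\<alpha>\<in>optimal_sets k \<nu>. \<forall>P. voronoi_partition \<alpha> P \<longrightarrow>
           (\<forall>a\<in>\<alpha>. cball a (g * diameter (P a \<inter> topological_support \<nu>)) \<subseteq> P a)"
proof -
  interpret prob_space \<nu>
    by fact
  have "measure \<nu> (cball x \<epsilon>) \<le> C * \<epsilon> powr t" if "\<epsilon> > 0" for x \<epsilon>
  proof -
    have "measure \<nu> (cball x \<epsilon>) \<le> (SUP x. measure \<nu> (cball x \<epsilon>))"
      by (intro cSUP_upper bdd_aboveI2[of _ _ 1]) auto
    with assms(7)[OF that] show ?thesis
      by simp
  qed
  then interpret frostman_measure \<nu> C t
    using assms by unfold_locales auto
  obtain \<eta> where "\<eta> > 0" and sep: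
    "\<And>\<alpha> a b. \<alpha> \<in> optimal_sets k \<nu> \<Longrightarrow> a \<in> \<alpha> \<Longrightarrow> b \<in> \<alpha> \<Longrightarrow> a \<noteq> b \<Longrightarrow> \<eta> \<le> dist a b"
    using optimal_sets_separated[of k] by metis
  show ?thesis
  \<comment> \<open>As the diameter of the cell within the support is at most 1, the radius is at
    most \<open>\<eta> / 3\<close>. Twice it stays strictly below \<open>\<eta>\<close>, which the
    factor \<open>1/2\<close> would not ensure.\<close>
  proof (intro exI[of _ "\<eta> / 3"] conjI ballI allI impI)
    fix \<alpha> P a
    assume \<alpha>: "\<alpha> \<in> optimal_sets k \<nu>" "voronoi_partition \<alpha> P" "a \<in> \<alpha>"
    have "diameter (P a \<inter> topological_support \<nu>) \<le> diameter (topological_support \<nu>)"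
      using assms by (intro diameter_subset compact_imp_bounded) auto
    then have "\<eta> / 3 * diameter (P a \<inter> topological_support \<nu>) \<le> \<eta> / 3 * 1"
      using assms \<open>\<eta> > 0\<close> by (intro mult_left_mono) auto
    then have "2 * (\<eta> / 3 * diameter (P a \<inter> topological_support \<nu>)) < \<eta>"
      using \<open>\<eta> > 0\<close> by linarith
    then show "cball a (\<eta> / 3 * diameter (P a \<inter> topological_support \<nu>)) \<subseteq> P a"
      using \<alpha>(2,3) sep[OF \<alpha>(1,3)]
      by (intro cball_subset_voronoi_cell) (auto intro: less_le_trans)
  qed (use \<open>\<eta> > 0\<close> in simp)
qed

end
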